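(* Let $n$ be any positive integer. Then $$Gm_{-n} = \frac{1}{2^n}\left[m_n+\frac{i}{2}\,m_{n+1}\right].$$
   Context: Here $i$ is the imaginary unit. The Mersenne Lucas numbers $\{m_n\}_{n\ge0}$ are defined by $m_0=2$, $m_1=3$, $m_n=3m_{n-1}-2m_{n-2}$ for $n\ge2$; they satisfy the Binet formula $m_n=2^n+1$, and they are extended to negative indices by replacing $n$ with $-n$ in this formula, i.e. $m_{-n}=2^{-n}+1$ for $n\geq 1$. The Gaussian Mersenne Lucas numbers $\{Gm_n\}_{n\ge 0}$ are defined by $Gm_0 = 2+\frac{3i}{2}$, $Gm_1 = 3+2i$, and $Gm_n = 3Gm_{n-1}-2Gm_{n-2}$ for $n\ge 2$; they satisfy $Gm_n=m_n+i\,m_{n-1}$ for $n\ge1$, and they are extended to negative indices by the same relation, i.e. $Gm_{-n}=m_{-n}+i\,m_{-n-1}$ for $n\ge1$. *)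

theory Defs
  imports Complex_Main
begin

fun mersenne_lucas_nat :: "nat \<Rightarrow> int" where
  "mersenne_lucas_nat 0 = 2"
| "mersenne_lucas_nat (Suc 0) = 3"
| "mersenne_lucas_nat (Suc (Suc n)) =
     3 * mersenne_lucas_nat (Suc n) - 2 * mersenne_lucas_nat n"

lemma mersenne_lucas_nat_binet: "mersenne_lucas_nat n = 2 ^ n + 1"
  by (induction n rule: mersenne_lucas_nat.induct) simp_all

text \<open>Negative indices are given by the Binet formula with a negative exponent, so
  the values there are no longer integers.\<close>

definition mersenne_lucas :: "int \<Rightarrow> real" where
  "mersenne_lucas k =
     (if 0 \<le> k then of_int (mersenne_lucas_nat (nat k)) else 2 powi k + 1)"

lemma mersenne_lucas_binet: "mersenne_lucas k = 2 powi k + 1"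
  by (simp add: mersenne_lucas_def mersenne_lucas_nat_binet power_int_def)

fun gaussian_mersenne_lucas_nat :: "nat \<Rightarrow> complex" where
  "gaussian_mersenne_lucas_nat 0 = 2 + 3 * \<i> / 2"
| "gaussian_mersenne_lucas_nat (Suc 0) = 3 + 2 * \<i>"
| "gaussian_mersenne_lucas_nat (Suc (Suc n)) =
     3 * gaussian_mersenne_lucas_nat (Suc n) - 2 * gaussian_mersenne_lucas_nat n"

definition gaussian_mersenne_lucas :: "int \<Rightarrow> complex" where
  "gaussian_mersenne_lucas k =
     (if 0 \<le> k then gaussian_mersenne_lucas_nat (nat k)
      else of_real (mersenne_lucas k) + \<i> * of_real (mersenne_lucas (k - 1)))"

text \<open>The relation used to extend the Gaussian numbers to negative indices does hold at
  the nonnegative ones, where they are given by the recurrence.\<close>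

lemma gaussian_mersenne_lucas_nat_eq:
  "gaussian_mersenne_lucas_nat n =
     of_real (mersenne_lucas (int n)) + \<i> * of_real (mersenne_lucas (int n - 1))"
  by (induction n rule: gaussian_mersenne_lucas_nat.induct)
     (simp_all add: mersenne_lucas_binet power_int_add power_int_diff field_simps)

lemma gaussian_mersenne_lucas_eq:
  "gaussian_mersenne_lucas k =
     of_real (mersenne_lucas k) + \<i> * of_real (mersenne_lucas (k - 1))"
  by (simp add: gaussian_mersenne_lucas_def gaussian_mersenne_lucas_nat_eq)

end

theory Submission
  imports Defs
begin

text \<open>The number \<open>2\<^sup>k + 1\<close> is the sum of the \<open>k\<close>-th powers of the roots \<open>1\<close> and \<open>2\<close> of
  \<open>x\<^sup>2 - 3 x + 2\<close>. Inverting both roots and clearing the denominator \<open>2\<^sup>k\<close>, which is the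
  \<open>k\<close>-th power of their product, merely exchanges the two summands. Hence the Mersenne Lucas
  numbers satisfy the reflection law \<open>mersenne_lucas_minus\<close>. The theorem is this law applied
  separately to the real part, of index \<open>-n\<close>, and the imaginary part, of index \<open>-(n + 1)\<close>,
  of a Gaussian Mersenne Lucas number; the imaginary part has one more power of \<open>2\<close> in its
  denominator, which gives the factor \<open>\<i> / 2\<close>.\<close>

lemma mersenne_lucas_minus: "mersenne_lucas (- k) = mersenne_lucas k / 2 powi k"
  by (simp add: mersenne_lucas_binet power_int_minus field_simps)

theorem theorem2:
  fixes n :: nat
  assumes "n > 0"
  shows "gaussian_mersenne_lucas (- int n) =
           1 / 2 ^ n * (of_real (mersenne_lucas (int n)) + \<i> / 2 * of_real (mersenne_lucas (int n + 1)))"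
proof -
  have real_part: "mersenne_lucas (- int n) = mersenne_lucas (int n) / 2 ^ n"
    by (simp add: mersenne_lucas_minus)
  have imaginary_part: "mersenne_lucas (- int n - 1) = mersenne_lucas (int n + 1) / (2 * 2 ^ n)"
    using mersenne_lucas_minus[of "int n + 1"] by (simp add: power_int_add)
  show ?thesis
    unfolding gaussian_mersenne_lucas_eq real_part imaginary_part
    by (simp add: field_simps)
qed

end
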